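(* Let $e\geq2$ and let $e'\in\{1,\dots,e-1\}$ be a divisor of $e$. Let $\alpha\in Q^{0}$ be such that $\sigma\cdot\alpha\in Q^{0}$. If $\lambda$ and $\mu$ are partitions with $\alpha(\lambda)=\alpha$ and $\alpha(\mu)=\sigma\cdot\alpha$, then $\lambda$ and $\mu$ have the same $e'$-core.
   Context: A partition is a finite non-increasing sequence $\lambda=(\lambda_1\ge\dots\ge\lambda_h>0)$ of positive integers (possibly empty), with nodes $(a,b)$, $1\le a\le h$, $1\le b\le\lambda_a$. The residue of $(a,b)$ is $b-a\bmod e$; $c_i(\lambda)$ is the number of nodes of residue $i\in\mathbb{Z}/e\mathbb{Z}$. $Q=\bigoplus_{i\in\mathbb{Z}/e\mathbb{Z}}\mathbb{Z}\alpha_i$ is free abelian with basis $(\alpha_i)$, $\alpha(\lambda):=\sum_ic_i(\lambda)\alpha_i$, $Q^{0}:=\{\alpha(\lambda):\lambda\text{ a partition}\}$, and $\sigma:Q\to Q$, $\alpha\mapsto\sigma\cdot\alpha$, is the $\mathbb{Z}$-linear map with $\sigma\cdot\alpha_i:=\alpha_{i-e'}$. The $e'$-core of a partition is the (well-defined) partition obtained by successively removing rim hooks of length $e'$ as long as possible. *)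

theory Defs
  imports "HOL-Algebra.Free_Abelian_Groups"
begin

definition is_partition :: "nat list \<Rightarrow> bool" where
  "is_partition lam \<longleftrightarrow> sorted_wrt (\<ge>) lam \<and> (\<forall>k \<in> set lam. k > 0)"

(* Rows and columns are numbered from 1, whereas list indexing starts at 0. *)
definition nodes :: "nat list \<Rightarrow> (nat \<times> nat) set" where
  "nodes lam = {(a, b). 1 \<le> a \<and> a \<le> length lam \<and> 1 \<le> b \<and> b \<le> lam ! (a - 1)}"

(* The elements of Z/eZ are represented by the integers 0, ..., e - 1. *)
definition residue :: "nat \<Rightarrow> nat \<times> nat \<Rightarrow> int" where
  "residue e = (\<lambda>(a, b). (int b - int a) mod int e)"

definition res_count :: "nat \<Rightarrow> int \<Rightarrow> nat list \<Rightarrow> nat" where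
  "res_count e i lam = card {x \<in> nodes lam. residue e x = i}"

definition Q :: "nat \<Rightarrow> (int \<Rightarrow>\<^sub>0 int) set" where
  "Q e = carrier (free_Abelian_group {0..<int e})"

(* The basis element alpha_i of Q, where i is any integer representing a class mod e. *)
definition basis_elt :: "nat \<Rightarrow> int \<Rightarrow> (int \<Rightarrow>\<^sub>0 int)" where
  "basis_elt e i = frag_of (i mod int e)"

definition content :: "nat \<Rightarrow> nat list \<Rightarrow> (int \<Rightarrow>\<^sub>0 int)" where
  "content e lam = (\<Sum>i \<in> {0..<int e}. frag_cmul (int (res_count e i lam)) (basis_elt e i))"

definition Q0 :: "nat \<Rightarrow> (int \<Rightarrow>\<^sub>0 int) set" where
  "Q0 e = {content e lam | lam. is_partition lam}"

definition sigma :: "nat \<Rightarrow> nat \<Rightarrow> (int \<Rightarrow>\<^sub>0 int) \<Rightarrow> (int \<Rightarrow>\<^sub>0 int)" where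
  "sigma e e' = frag_extend (\<lambda>i. basis_elt e (i - int e'))"

(* The part of the rim between the hand and the foot of the hook of the node (a, b);
   every rim hook is of this form for a unique node, and its length is its cardinality. *)
definition rim_hook :: "nat list \<Rightarrow> nat \<times> nat \<Rightarrow> (nat \<times> nat) set" where
  "rim_hook lam = (\<lambda>(a, b).
     {(a', b'). (a', b') \<in> nodes lam \<and> a \<le> a' \<and> b \<le> b' \<and> (a' + 1, b' + 1) \<notin> nodes lam})"

definition remove_rim_hook :: "nat \<Rightarrow> nat list \<Rightarrow> nat list \<Rightarrow> bool" where
  "remove_rim_hook l lam mu \<longleftrightarrow> is_partition lam \<and> is_partition mu \<and>
     (\<exists>x \<in> nodes lam. card (rim_hook lam x) = l \<and> nodes mu = nodes lam - rim_hook lam x)"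

definition is_core_of :: "nat \<Rightarrow> nat list \<Rightarrow> nat list \<Rightarrow> bool" where
  "is_core_of l lam kap \<longleftrightarrow>
     (remove_rim_hook l)\<^sup>*\<^sup>* lam kap \<and> \<not> (\<exists>mu. remove_rim_hook l kap mu)"

(* For l >= 1 and a partition lam there is exactly one such kap: the result does not depend
   on the order in which the rim hooks are removed. *)
definition core :: "nat \<Rightarrow> nat list \<Rightarrow> nat list" where
  "core l lam = (THE kap. is_core_of l lam kap)"

lemma basis_elt_in_Q: "e > 0 \<Longrightarrow> basis_elt e i \<in> Q e"
  by (simp add: basis_elt_def Q_def)

lemma Q0_subset_Q: "e > 0 \<Longrightarrow> Q0 e \<subseteq> Q e"
proof (clarsimp simp: Q0_def)
  fix lam assume "e > 0"
  have "Poly_Mapping.keys (content e lam) \<subseteq>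
      (\<Union>i \<in> {0..<int e}. Poly_Mapping.keys (frag_cmul (int (res_count e i lam)) (basis_elt e i)))"
    unfolding content_def by (rule keys_sum)
  also have "\<dots> \<subseteq> (\<Union>i \<in> {0..<int e}. Poly_Mapping.keys (basis_elt e i))"
    using keys_cmul by blast
  also have "\<dots> \<subseteq> {0..<int e}"
    using \<open>e > 0\<close> by (auto simp: basis_elt_def)
  finally show "content e lam \<in> Q e" by (simp add: Q_def)
qed

lemma sigma_basis_elt:
  "sigma e e' (basis_elt e i) = basis_elt e (i - int e')"
  by (simp add: sigma_def basis_elt_def mod_simps)

lemma sigma_add: "sigma e e' (x + y) = sigma e e' x + sigma e e' y"
  by (simp add: sigma_def frag_extend_add)

end

theory Submission
  imports Defs
begin

text \<open>
  Let \<open>d = e'\<close>. Since \<open>d\<close> divides \<open>e\<close>, reducing residues modulo \<open>d\<close> defines a linear map from the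
  free abelian group on the residues modulo \<open>e\<close> to the one on the residues modulo \<open>d\<close>. It sends
  the content modulo \<open>e\<close> of a partition to its content modulo \<open>d\<close>, and it does not see \<open>\<sigma>\<close>,
  which shifts residues by \<open>d\<close>. So the two partitions have equally many nodes of each residue
  modulo \<open>d\<close>, and the theorem reduces to the classical fact that these numbers determine the
  \<open>d\<close>-core (\<open>core_eq_of_res_count_eq\<close>).

  For that fact, describe a partition by its boundary path: \<open>rim_row D k\<close> is the row in which the
  diagonal of content \<open>k\<close> leaves the diagram \<open>D\<close>. From \<open>k\<close> to \<open>k + 1\<close> this row either stays the
  same or drops by one; call the second case a descent at \<open>k\<close>. The descents are the positions of
  the beads in the abacus (beta-set) of the partition, and two facts about them are needed.

  A rim hook meets an interval of diagonals, in one node each. A rim hook of length \<open>l\<close> therefore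
  contains each residue modulo \<open>l\<close> exactly once, so removing it lowers all residue counts by one
  (\<open>res_count_remove_rim_hook\<close>). Conversely, a descent at \<open>k\<close> without a descent at \<open>k - l\<close> marks
  the two ends of a rim hook of length \<open>l\<close>, so that in an \<open>l\<close>-core the descents are closed under
  subtracting \<open>l\<close> (\<open>rim_row_descent_of_core\<close>).

  Now take two \<open>l\<close>-cores whose residue counts differ by a constant, and look at one residue class.
  Both sets of descents are initial segments of the class, so one contains the other, and
  they differ by finitely many elements. The number of these is the gap between the residue counts
  of this class and the next for one core, minus the same gap for the other core, up to sign; hence
  it is zero. The descents agree, hence the paths, hence the partitions
  (\<open>core_eq_of_res_count_diff\<close>). Applied to one partition, this also shows that the core is well
  defined.
\<close>

section \<open>Young diagrams as sets of nodes\<close>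

text \<open>A partition minus a rim hook is easiest to describe as a set of nodes; these are the sets that
  are diagrams of partitions.\<close>

definition young_diagram :: "(nat \<times> nat) set \<Rightarrow> bool" where
  "young_diagram D \<longleftrightarrow> finite D \<and> D \<subseteq> {1..} \<times> {1..} \<and>
     (\<forall>a b a' b'. (a, b) \<in> D \<longrightarrow> 1 \<le> a' \<longrightarrow> a' \<le> a \<longrightarrow> 1 \<le> b' \<longrightarrow> b' \<le> b \<longrightarrow> (a', b') \<in> D)"

lemma young_diagram_down:
  "young_diagram D \<Longrightarrow> (a, b) \<in> D \<Longrightarrow> 1 \<le> a' \<Longrightarrow> a' \<le> a \<Longrightarrow> 1 \<le> b' \<Longrightarrow> b' \<le> b \<Longrightarrow> (a', b') \<in> D"
  unfolding young_diagram_def by blast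

lemma young_diagram_nodes:
  assumes "is_partition lam"
  shows "young_diagram (nodes lam)"
proof -
  have "nodes lam \<subseteq> {1..length lam} \<times> {1..sum_list lam}"
  proof (unfold nodes_def, clarsimp)
    fix a b assume "Suc 0 \<le> a" "a \<le> length lam" "b \<le> lam ! (a - Suc 0)"
    then have "lam ! (a - Suc 0) \<le> sum_list lam" by (intro member_le_sum_list nth_mem) auto
    then show "b \<le> sum_list lam" using \<open>b \<le> lam ! (a - Suc 0)\<close> by (rule le_trans[rotated])
  qed
  then have fin: "finite (nodes lam)" by (rule finite_subset) simp
  have mono: "lam ! i \<ge> lam ! j" if "i \<le> j" "j < length lam" for i j
    using assms that sorted_wrt_nth_less[of "(\<ge>)" lam i j]
    unfolding is_partition_def by (cases "i = j") auto
  have "(a', b') \<in> nodes lam" if "(a, b) \<in> nodes lam" "1 \<le> a'" "a' \<le> a" "1 \<le> b'" "b' \<le> b" for a b a' b'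
  proof -
    have "lam ! (a - 1) \<le> lam ! (a' - 1)"
      by (rule mono) (use that in \<open>auto simp: nodes_def\<close>)
    then show ?thesis using that by (auto simp: nodes_def)
  qed
  then show ?thesis using fin unfolding young_diagram_def by (auto simp: nodes_def)
qed

text \<open>An initial segment of the positive integers is recorded by its cardinality; this recovers
  the parts of a partition from the rows of its diagram, and the number of parts from the first
  column.\<close>

lemma initial_segment_eq_card:
  fixes S :: "nat set"
  assumes "finite S" "S \<subseteq> {1..}" "\<And>x y. x \<in> S \<Longrightarrow> 1 \<le> y \<Longrightarrow> y \<le> x \<Longrightarrow> y \<in> S"
  shows "S = {1..card S}"
proof (cases "S = {}")
  case False
  have "S = {1..Max S}"
  proof
    show "S \<subseteq> {1..Max S}" using assms by auto
    show "{1..Max S} \<subseteq> S" using assms(3)[OF Max_in[OF assms(1) False]] by auto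
  qed
  then show ?thesis by (metis card_atLeastAtMost diff_Suc_1)
qed auto

lemma partition_of_young_diagram:
  assumes D: "young_diagram D"
  obtains lam where "is_partition lam" "nodes lam = D"
proof -
  define row where "row a = card {b. (a, b) \<in> D}" for a
  define h where "h = card {a. (a, 1) \<in> D}"
  define lam where "lam = map (\<lambda>i. row (Suc i)) [0..<h]"
  have fin: "finite D" and pos: "D \<subseteq> {1..} \<times> {1..}" using D unfolding young_diagram_def by auto
  have fin_row: "finite {b. (a, b) \<in> D}" for a
    by (rule finite_subset[of _ "snd ` D"]) (use fin in force)+
  have fin_col: "finite {a. (a, 1) \<in> D}"
    by (rule finite_subset[of _ "fst ` D"]) (use fin in force)+
  have row: "{b. (a, b) \<in> D} = {1..row a}" for a
    unfolding row_def
  proof (rule initial_segment_eq_card[OF fin_row])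
    show "{b. (a, b) \<in> D} \<subseteq> {1..}" using pos by auto
    fix x y assume "x \<in> {b. (a, b) \<in> D}" "1 \<le> y" "y \<le> x"
    then show "y \<in> {b. (a, b) \<in> D}" using young_diagram_down[OF D, of a x a y] pos by auto
  qed
  have col: "{a. (a, 1) \<in> D} = {1..h}"
    unfolding h_def
  proof (rule initial_segment_eq_card[OF fin_col])
    show "{a. (a, 1) \<in> D} \<subseteq> {1..}" using pos by auto
    fix x y assume "x \<in> {a. (a, 1) \<in> D}" "1 \<le> y" "y \<le> x"
    then show "y \<in> {a. (a, 1) \<in> D}" using young_diagram_down[OF D, of x 1 y 1] pos by auto
  qed
  have in_D: "(a, b) \<in> D \<longleftrightarrow> 1 \<le> b \<and> b \<le> row a" for a b
    using eqset_imp_iff[OF row[of a], of b] by simp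
  have in_col: "(a, 1) \<in> D \<longleftrightarrow> 1 \<le> a \<and> a \<le> h" for a
    using eqset_imp_iff[OF col, of a] by simp
  have row_anti: "row a \<le> row a'" if "1 \<le> a'" "a' \<le> a" for a a'
  proof (cases "row a = 0")
    case False
    then have "(a, row a) \<in> D" by (simp add: in_D)
    then have "(a', row a) \<in> D" using young_diagram_down[OF D] that False by simp
    then show ?thesis by (simp add: in_D)
  qed simp
  have "is_partition lam"
    unfolding is_partition_def
  proof
    show "sorted_wrt (\<ge>) lam"
      unfolding sorted_wrt_iff_nth_less lam_def by (auto intro: row_anti)
    have "row (Suc i) > 0" if "i < h" for i
      using in_col[of "Suc i"] that by (simp add: in_D)
    then show "\<forall>k\<in>set lam. 0 < k" by (auto simp: lam_def)
  qed
  moreover have "nodes lam = D"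
  proof (rule Set.set_eqI, clarify)
    fix a b
    have a: "1 \<le> a \<and> a \<le> h" if ab: "(a, b) \<in> D"
    proof -
      have "1 \<le> a" "1 \<le> b" using ab pos by auto
      then have "(a, 1) \<in> D" using young_diagram_down[OF D ab, of a 1] by simp
      then show ?thesis by (simp only: in_col)
    qed
    show "(a, b) \<in> nodes lam \<longleftrightarrow> (a, b) \<in> D"
    proof (cases "1 \<le> a \<and> a \<le> h")
      case True
      then have "lam ! (a - 1) = row a" by (cases a) (auto simp: lam_def)
      then show ?thesis using True by (simp add: nodes_def in_D) (simp add: lam_def)
    next
      case False
      then show ?thesis using a by (auto simp: nodes_def lam_def)
    qed
  qed
  ultimately show ?thesis by (rule that)
qed

lemma nodes_inj:
  assumes "is_partition lam" "is_partition mu" "nodes lam = nodes mu"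
  shows "lam = mu"
proof -
  have col: "{a. (a, 1) \<in> nodes lam} = {1..length lam}" if "is_partition lam" for lam
    using that unfolding nodes_def is_partition_def by (auto simp: Suc_le_eq)
  have row: "{b. (Suc i, b) \<in> nodes lam} = {1..lam ! i}" if "i < length lam" for lam i
    using that unfolding nodes_def by auto
  have len: "length lam = length mu"
    using col[OF assms(1)] col[OF assms(2)] assms(3) by (metis card_atLeastAtMost diff_Suc_1)
  show ?thesis
  proof (rule nth_equalityI[OF len])
    fix i assume "i < length lam"
    then show "lam ! i = mu ! i"
      using row[of i lam] row[of i mu] len assms(3) by (metis card_atLeastAtMost diff_Suc_1)
  qed
qed

section \<open>The boundary path\<close>

definition diagonal :: "(nat \<times> nat) set \<Rightarrow> int \<Rightarrow> (nat \<times> nat) set" where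
  "diagonal D k = {x \<in> D. int (snd x) - int (fst x) = k}"

text \<open>Diagonal \<open>k\<close> starts just below row \<open>max 0 (- k)\<close>, and a diagram fills an initial segment of it.
  Hence this is the row of the last node on the diagonal. On an empty diagonal it is the row just
  before the start, which makes the values for all integers \<open>k\<close> fit together into one path.\<close>

definition rim_row :: "(nat \<times> nat) set \<Rightarrow> int \<Rightarrow> int" where
  "rim_row D k = max 0 (- k) + int (card (diagonal D k))"

text \<open>The diagram together with everything above and to the left of the quadrant of positive
  coordinates. This set is closed under decreasing either coordinate among all integers, so that
  the boundary can be followed past the ends of the diagram without case distinctions.\<close>

definition extended :: "(nat \<times> nat) set \<Rightarrow> int \<Rightarrow> int \<Rightarrow> bool" where
  "extended D a b \<longleftrightarrow> a \<le> 0 \<or> b \<le> 0 \<or> (nat a, nat b) \<in> D"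

lemma extended_down:
  assumes "young_diagram D" "extended D a b" "a' \<le> a" "b' \<le> b"
  shows "extended D a' b'"
proof (cases "a' \<le> 0 \<or> b' \<le> 0")
  case False
  then show ?thesis
    using assms young_diagram_down[OF assms(1), of "nat a" "nat b" "nat a'" "nat b'"]
    unfolding extended_def by auto
qed (auto simp: extended_def)

lemma int_down_set_eq_atMost:
  fixes P :: "int \<Rightarrow> bool"
  assumes "P z" "\<And>a. P a \<Longrightarrow> a \<le> B" "\<And>a a'. P a \<Longrightarrow> a' \<le> a \<Longrightarrow> P a'"
  obtains m where "\<And>a. P a \<longleftrightarrow> a \<le> m"
proof -
  define S where "S = {a. P a \<and> z \<le> a}"
  have fin: "finite S" by (rule finite_subset[of _ "{z..B}"]) (use assms in \<open>auto simp: S_def\<close>)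
  have ne: "S \<noteq> {}" using assms(1) by (auto simp: S_def)
  have m: "Max S \<in> S" by (rule Max_in[OF fin ne])
  have "P a \<longleftrightarrow> a \<le> Max S" for a
  proof
    assume "P a"
    show "a \<le> Max S"
    proof (cases "z \<le> a")
      case True then show ?thesis using \<open>P a\<close> fin by (auto simp: S_def)
    next
      case False then show ?thesis using m by (auto simp: S_def)
    qed
  next
    assume "a \<le> Max S" then show "P a" using m assms(3) by (auto simp: S_def)
  qed
  then show ?thesis by (rule that)
qed

text \<open>The cardinality in the definition of \<open>rim_row\<close> really is a position: on each diagonal the
  extended diagram is a ray ending in some row \<open>m\<close>, and the positive part of the ray has
  \<open>m - max 0 (- k)\<close> nodes.\<close>

lemma extended_iff_le_rim_row:
  assumes D: "young_diagram D"
  shows "extended D a (a + k) \<longleftrightarrow> a \<le> rim_row D k"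
proof -
  have fin: "finite D" and pos: "D \<subseteq> {1..} \<times> {1..}" using D unfolding young_diagram_def by auto
  obtain B where B: "\<And>x. x \<in> D \<Longrightarrow> int (fst x) \<le> B"
    using fin by (metis Max_ge finite_imageI imageI image_image)
  have bound: "a \<le> max B (max 0 (- k))" if "extended D a (a + k)" for a
    using that B[of "(nat a, nat (a + k))"] unfolding extended_def by (auto split: if_splits)
  obtain m where m: "\<And>a. extended D a (a + k) \<longleftrightarrow> a \<le> m"
  proof (rule int_down_set_eq_atMost[of "\<lambda>a. extended D a (a + k)" 0 "max B (max 0 (- k))"])
    show "extended D 0 (0 + k)" by (simp add: extended_def)
    show "\<And>a. extended D a (a + k) \<Longrightarrow> a \<le> max B (max 0 (- k))" by (rule bound)
    show "\<And>a a'. extended D a (a + k) \<Longrightarrow> a' \<le> a \<Longrightarrow> extended D a' (a' + k)"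
      by (erule extended_down[OF D]) auto
  qed blast
  have ge: "max 0 (- k) \<le> m" using m[of "max 0 (- k)"] by (auto simp: extended_def)
  have "diagonal D k = (\<lambda>a. (nat a, nat (a + k))) ` {max 0 (- k) <.. m}"
  proof (rule Set.set_eqI, clarify)
    fix a b
    show "(a, b) \<in> diagonal D k \<longleftrightarrow> (a, b) \<in> (\<lambda>a. (nat a, nat (a + k))) ` {max 0 (- k) <.. m}"
    proof
      assume A: "(a, b) \<in> diagonal D k"
      then have "a \<ge> 1" "b \<ge> 1" "int b = int a + k" "(a, b) \<in> D" using pos by (auto simp: diagonal_def)
      then have "extended D (int a) (int a + k)" by (metis extended_def nat_int)
      then have "int a \<le> m" by (simp add: m)
      then have "int a \<in> {max 0 (- k) <.. m}" using \<open>a \<ge> 1\<close> \<open>b \<ge> 1\<close> \<open>int b = int a + k\<close> by auto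
      moreover have "(a, b) = (nat (int a), nat (int a + k))" using \<open>int b = int a + k\<close> by auto
      ultimately show "(a, b) \<in> (\<lambda>a. (nat a, nat (a + k))) ` {max 0 (- k) <.. m}" by blast
    next
      assume "(a, b) \<in> (\<lambda>a. (nat a, nat (a + k))) ` {max 0 (- k) <.. m}"
      then obtain c where c: "a = nat c" "b = nat (c + k)" "max 0 (- k) < c" "c \<le> m" by auto
      then have "extended D c (c + k)" by (simp add: m)
      then show "(a, b) \<in> diagonal D k" using c by (auto simp: extended_def diagonal_def)
    qed
  qed
  moreover have "inj_on (\<lambda>a. (nat a, nat (a + k))) {max 0 (- k) <.. m}"
    by (auto simp: inj_on_def)
  ultimately have "card (diagonal D k) = nat (m - max 0 (- k))"
    by (simp add: card_image)
  then have "rim_row D k = m" using ge by (simp add: rim_row_def)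
  then show ?thesis by (simp add: m)
qed

lemma mem_iff_le_rim_row:
  assumes D: "young_diagram D"
  shows "(a, b) \<in> D \<longleftrightarrow> 1 \<le> a \<and> 1 \<le> b \<and> int a \<le> rim_row D (int b - int a)"
proof -
  have "D \<subseteq> {1..} \<times> {1..}" using D unfolding young_diagram_def by auto
  then show ?thesis
    using extended_iff_le_rim_row[OF D, of "int a" "int b - int a"] by (auto simp: extended_def)
qed

text \<open>The boundary point of one diagonal, moved one column to the left or one row up, lands on the
  adjacent diagonal and stays in the extended diagram.\<close>

lemma rim_row_step:
  assumes D: "young_diagram D"
  shows "rim_row D (k + 1) \<le> rim_row D k" "rim_row D k \<le> rim_row D (k + 1) + 1"
proof -
  let ?r = "rim_row D"
  have "extended D (?r (k + 1)) (?r (k + 1) + (k + 1))" by (simp add: extended_iff_le_rim_row[OF D])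
  then have "extended D (?r (k + 1)) (?r (k + 1) + k)" by (rule extended_down[OF D]) auto
  then show "?r (k + 1) \<le> ?r k" by (simp add: extended_iff_le_rim_row[OF D])
  have "extended D (?r k) (?r k + k)" by (simp add: extended_iff_le_rim_row[OF D])
  then have "extended D (?r k - 1) ((?r k - 1) + (k + 1))" by (rule extended_down[OF D]) auto
  then show "?r k \<le> ?r (k + 1) + 1" unfolding extended_iff_le_rim_row[OF D] by simp
qed

lemma rim_row_antimono:
  assumes D: "young_diagram D" and "j \<le> k"
  shows "rim_row D k \<le> rim_row D j"
  using assms(2) by (induction k rule: int_ge_induct) (use rim_row_step(1)[OF D] in \<open>auto intro: order.trans\<close>)

lemma rim_col_mono:
  assumes D: "young_diagram D" and "j \<le> k"
  shows "rim_row D j + j \<le> rim_row D k + k"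
  using assms(2)
proof (induction k rule: int_ge_induct)
  case (step i)
  then show ?case using rim_row_step(2)[OF D, of i] by linarith
qed simp

section \<open>Rim hooks\<close>

definition rim_node :: "(nat \<times> nat) set \<Rightarrow> int \<Rightarrow> nat \<times> nat" where
  "rim_node D k = (nat (rim_row D k), nat (rim_row D k + k))"

text \<open>The contents of the nodes of the rim hook of \<open>x\<close>, that is, the diagonals whose last node lies
  weakly below and to the right of \<open>x\<close>.\<close>

definition hook_contents :: "(nat \<times> nat) set \<Rightarrow> nat \<times> nat \<Rightarrow> int set" where
  "hook_contents D x = {k. int (fst x) \<le> rim_row D k \<and> int (snd x) \<le> rim_row D k + k}"

text \<open>The rim consists of the last nodes of the nonempty diagonals, because a node is last on its
  diagonal if and only if its south-east neighbour is outside the diagram. No diagonal in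
  \<open>hook_contents\<close> is empty, as its boundary point is weakly south-east of the node \<open>x\<close>.\<close>

lemma rim_hook_eq_image:
  assumes lam: "is_partition lam" and x: "x \<in> nodes lam"
  shows "rim_hook lam x = rim_node (nodes lam) ` hook_contents (nodes lam) x"
proof -
  let ?D = "nodes lam"
  have D: "young_diagram ?D" by (rule young_diagram_nodes[OF lam])
  obtain a b where [simp]: "x = (a, b)" by (cases x)
  have ab: "a \<ge> 1" "b \<ge> 1" using x by (auto simp: mem_iff_le_rim_row[OF D])
  show ?thesis
  proof (rule Set.set_eqI, clarify)
    fix c d
    show "(c, d) \<in> rim_hook lam x \<longleftrightarrow> (c, d) \<in> rim_node ?D ` hook_contents ?D x"
    proof
      assume "(c, d) \<in> rim_hook lam x"
      then have 1: "(c, d) \<in> ?D" "(c + 1, d + 1) \<notin> ?D" "a \<le> c" "b \<le> d" by (auto simp: rim_hook_def)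
      then have "int c = rim_row ?D (int d - int c)"
        by (auto simp: mem_iff_le_rim_row[OF D])
      then have "(c, d) = rim_node ?D (int d - int c)" "int d - int c \<in> hook_contents ?D x"
        using 1 by (auto simp: rim_node_def hook_contents_def)
      then show "(c, d) \<in> rim_node ?D ` hook_contents ?D x" by blast
    next
      assume "(c, d) \<in> rim_node ?D ` hook_contents ?D x"
      then obtain k where k: "c = nat (rim_row ?D k)" "d = nat (rim_row ?D k + k)"
        "int a \<le> rim_row ?D k" "int b \<le> rim_row ?D k + k"
        by (auto simp: rim_node_def hook_contents_def)
      then have "int d - int c = k" "int c = rim_row ?D k" by auto
      then show "(c, d) \<in> rim_hook lam x"
        using k ab by (auto simp: rim_hook_def mem_iff_le_rim_row[OF D])
    qed
  qed
qed

lemma content_rim_node: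
  assumes "k \<in> hook_contents D x"
  shows "int (snd (rim_node D k)) - int (fst (rim_node D k)) = k"
  using assms by (auto simp: rim_node_def hook_contents_def)

lemma inj_on_rim_node: "inj_on (rim_node D) (hook_contents D x)"
  by (rule inj_on_inverseI[of _ "\<lambda>y. int (snd y) - int (fst y)"]) (rule content_rim_node)

lemma finite_convex_int_set:
  fixes S :: "int set"
  assumes "finite S" "\<And>i j k. i \<in> S \<Longrightarrow> k \<in> S \<Longrightarrow> i \<le> j \<Longrightarrow> j \<le> k \<Longrightarrow> j \<in> S"
  obtains s where "S = {s..<s + int (card S)}"
proof (cases "S = {}")
  case False
  have "S = {Min S..Max S}"
  proof
    show "S \<subseteq> {Min S..Max S}" using assms(1) by auto
    show "{Min S..Max S} \<subseteq> S"
      using assms(2)[OF Min_in[OF assms(1) False] Max_in[OF assms(1) False]] by auto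
  qed
  then obtain s t where S: "S = {s..t}" by blast
  then have "s \<le> t" using False by auto
  then have "S = {s..<s + int (card S)}" unfolding S by auto
  then show ?thesis by (rule that)
qed (use that in simp)

lemma card_residue_interval:
  assumes "0 \<le> j" "j < int l"
  shows "card {k \<in> {s..<s + int l}. k mod int l = j} = 1"
proof -
  have "{k \<in> {s..<s + int l}. k mod int l = j} = {s + (j - s) mod int l}"
  proof (rule Set.set_eqI, rule iffI)
    fix k assume "k \<in> {k \<in> {s..<s + int l}. k mod int l = j}"
    then have k: "0 \<le> k - s" "k - s < int l" "k mod int l = j" by auto
    then have "(j - s) mod int l = (k - s) mod int l" by (auto simp: mod_simps)
    then show "k \<in> {s + (j - s) mod int l}" using k by simp
  next
    fix k assume "k \<in> {s + (j - s) mod int l}"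
    then have k: "k = s + (j - s) mod int l" by simp
    have "0 \<le> (j - s) mod int l" "(j - s) mod int l < int l" using assms by auto
    moreover have "k mod int l = j" unfolding k using assms by (simp add: mod_simps)
    ultimately show "k \<in> {k \<in> {s..<s + int l}. k mod int l = j}" using k by auto
  qed
  then show ?thesis by simp
qed

text \<open>Along the boundary path rows decrease and columns increase, so the diagonals met by a rim hook
  form an interval; as the hook has one node on each of them, the interval has length \<open>l\<close>.\<close>

lemma card_residue_rim_hook:
  assumes lam: "is_partition lam" and x: "x \<in> nodes lam" and l: "card (rim_hook lam x) = l"
    and j: "0 \<le> j" "j < int l"
  shows "card {y \<in> rim_hook lam x. residue l y = j} = 1"
proof -
  let ?D = "nodes lam" and ?K = "hook_contents (nodes lam) x"
  have D: "young_diagram ?D" by (rule young_diagram_nodes[OF lam])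
  note inj = inj_on_rim_node[of ?D x]
  note im = rim_hook_eq_image[OF lam x]
  have "finite (rim_hook lam x)"
    by (rule finite_subset[of _ ?D])
      (use D in \<open>auto simp: rim_hook_def young_diagram_def split: prod.splits\<close>)
  then have fin: "finite ?K" using finite_imageD[OF _ inj] im by simp
  have convex: "j \<in> ?K" if "i \<in> ?K" "k \<in> ?K" "i \<le> j" "j \<le> k" for i j k
    using that rim_row_antimono[OF D, of j k] rim_col_mono[OF D, of i j]
    by (auto simp: hook_contents_def)
  obtain s where "?K = {s..<s + int (card ?K)}"
    by (rule finite_convex_int_set[OF fin convex]) 
  moreover have "card ?K = l" using l im inj by (simp add: card_image)
  ultimately have K: "?K = {s..<s + int l}" by simp
  have "{y \<in> rim_hook lam x. residue l y = j} = rim_node ?D ` {k \<in> ?K. k mod int l = j}"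
    unfolding im using content_rim_node[of _ ?D x] by (auto simp: residue_def split_beta)
  also have "card \<dots> = card {k \<in> ?K. k mod int l = j}"
    by (rule card_image[OF inj_on_subset[OF inj]]) auto
  also have "\<dots> = 1" unfolding K by (rule card_residue_interval[OF j])
  finally show ?thesis .
qed

lemma res_count_remove_rim_hook:
  assumes rem: "remove_rim_hook l lam mu" and j: "0 \<le> j" "j < int l"
  shows "res_count l j lam = res_count l j mu + 1"
proof -
  obtain x where x: "is_partition lam" "x \<in> nodes lam" "card (rim_hook lam x) = l"
    and mu: "nodes mu = nodes lam - rim_hook lam x"
    using rem unfolding remove_rim_hook_def by blast
  have sub: "rim_hook lam x \<subseteq> nodes lam" by (auto simp: rim_hook_def split: prod.splits)
  have fin: "finite (nodes lam)" using young_diagram_nodes[OF x(1)] by (simp add: young_diagram_def)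
  have "{y \<in> nodes lam. residue l y = j} =
      {y \<in> nodes mu. residue l y = j} \<union> {y \<in> rim_hook lam x. residue l y = j}"
    using mu sub by auto
  moreover have "card ({y \<in> nodes mu. residue l y = j} \<union> {y \<in> rim_hook lam x. residue l y = j}) =
      card {y \<in> nodes mu. residue l y = j} + card {y \<in> rim_hook lam x. residue l y = j}"
    by (rule card_Un_disjoint) (use mu fin finite_subset[OF sub fin] in auto)
  ultimately show ?thesis
    unfolding res_count_def using card_residue_rim_hook[OF x j] by simp
qed

text \<open>Every hook can be removed: if a node \<open>z\<close> stays, then so do all nodes \<open>z'\<close> to its north-west.
  Indeed, if \<open>z'\<close> were in the rim hook, then \<open>z\<close> would also lie south-east of \<open>x\<close> and on the rim.\<close>

lemma remove_rim_hook_exists: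
  assumes lam: "is_partition lam" and x: "x \<in> nodes lam"
  shows "\<exists>mu. remove_rim_hook (card (rim_hook lam x)) lam mu"
proof -
  have D: "young_diagram (nodes lam)" by (rule young_diagram_nodes[OF lam])
  obtain a b where [simp]: "x = (a, b)" by (cases x)
  have "(c', d') \<in> nodes lam - rim_hook lam x"
    if cd: "(c, d) \<in> nodes lam - rim_hook lam x" and le: "1 \<le> c'" "c' \<le> c" "1 \<le> d'" "d' \<le> d" for c d c' d'
  proof -
    have "(c', d') \<in> nodes lam" using young_diagram_down[OF D] cd le by blast
    moreover have "(c', d') \<notin> rim_hook lam x"
    proof
      assume "(c', d') \<in> rim_hook lam x"
      then have "a \<le> c'" "b \<le> d'" "(c' + 1, d' + 1) \<notin> nodes lam" by (auto simp: rim_hook_def)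
      moreover from this have "(c + 1, d + 1) \<notin> nodes lam"
        using young_diagram_down[OF D, of "c + 1" "d + 1" "c' + 1" "d' + 1"] le by auto
      ultimately show False using cd le by (auto simp: rim_hook_def)
    qed
    ultimately show ?thesis by blast
  qed
  then have "young_diagram (nodes lam - rim_hook lam x)"
    using D unfolding young_diagram_def by (meson Diff_subset finite_Diff order_trans)
  then obtain mu where "is_partition mu" "nodes mu = nodes lam - rim_hook lam x"
    by (rule partition_of_young_diagram)
  then show ?thesis using lam x unfolding remove_rim_hook_def by blast
qed

text \<open>Otherwise there is a hook with arm ending on diagonal \<open>k\<close> and leg ending on diagonal
  \<open>k - l + 1\<close>. Its corner is the node in the row in which diagonal \<open>k\<close> leaves the diagram and in
  the column in which diagonal \<open>k - l + 1\<close> does.\<close>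

lemma rim_row_descent_of_core:
  assumes lam: "is_partition lam" and core: "\<nexists>mu. remove_rim_hook l lam mu" and l: "l \<ge> 1"
    and desc: "rim_row (nodes lam) k \<noteq> rim_row (nodes lam) (k + 1)"
  shows "rim_row (nodes lam) (k - int l) \<noteq> rim_row (nodes lam) (k - int l + 1)"
proof
  let ?D = "nodes lam" and ?r = "rim_row (nodes lam)"
  have D: "young_diagram ?D" by (rule young_diagram_nodes[OF lam])
  define y where "y = k - int l"
  assume "?r (k - int l) = ?r (k - int l + 1)"
  then have flat: "?r y = ?r (y + 1)" by (simp add: y_def)
  have desc: "?r k = ?r (k + 1) + 1" using desc rim_row_step[OF D, of k] by simp
  have nonneg: "0 \<le> ?r i" "0 \<le> ?r i + i" for i by (auto simp: rim_row_def)
  \<comment> \<open>The path is flat at \<open>y\<close>, so \<open>?r y + y + 1\<close> is the column of the boundary point on diagonal \<open>y + 1\<close>.\<close>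
  define x where "x = (nat (?r k), nat (?r y + y + 1))"
  have fst_x: "int (fst x) = ?r k" and snd_x: "int (snd x) = ?r y + y + 1"
    using nonneg(1)[of k] nonneg(2)[of y] by (auto simp: x_def)
  have K: "hook_contents ?D x = {y + 1..k}"
  proof (rule Set.set_eqI)
    fix i
    have "?r k \<le> ?r i \<longleftrightarrow> i \<le> k"
    proof
      assume "?r k \<le> ?r i"
      then show "i \<le> k" using rim_row_antimono[OF D, of "k + 1" i] desc by fastforce
    qed (rule rim_row_antimono[OF D])
    moreover have "?r y + y + 1 \<le> ?r i + i \<longleftrightarrow> y + 1 \<le> i"
    proof
      assume "?r y + y + 1 \<le> ?r i + i"
      then show "y + 1 \<le> i" using rim_col_mono[OF D, of i y] by fastforce
    next
      assume "y + 1 \<le> i"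
      then show "?r y + y + 1 \<le> ?r i + i" using rim_col_mono[OF D, of "y + 1" i] flat by simp
    qed
    ultimately show "i \<in> hook_contents ?D x \<longleftrightarrow> i \<in> {y + 1..k}"
      by (auto simp: hook_contents_def fst_x snd_x)
  qed
  have "y + 1 \<le> k" using l by (simp add: y_def)
  have "x \<in> ?D"
  proof -
    have "k \<in> hook_contents ?D x" using K \<open>y + 1 \<le> k\<close> by simp
    then have *: "int (snd x) \<le> ?r k + k" by (simp add: hook_contents_def)
    then have "?r k \<le> ?r (int (snd x) - int (fst x))"
      by (intro rim_row_antimono[OF D]) (simp add: fst_x)
    moreover have "1 \<le> fst x" using fst_x desc nonneg(1)[of "k + 1"] by linarith
    moreover have "1 \<le> snd x" using snd_x nonneg(2)[of y] by linarith
    ultimately show ?thesis using fst_x mem_iff_le_rim_row[OF D, of "fst x" "snd x"] by simp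
  qed
  moreover from this have "card (rim_hook lam x) = l"
    using rim_hook_eq_image[OF lam, of x] inj_on_rim_node[of ?D x] K
    by (simp add: card_image y_def)
  ultimately show False using remove_rim_hook_exists[OF lam] core by metis
qed

section \<open>Cores are determined by their residue counts up to a constant\<close>

lemma finite_int_interval_Collect: "finite {k :: int. a \<le> k \<and> k \<le> b \<and> P k}"
proof -
  have "{k :: int. a \<le> k \<and> k \<le> b \<and> P k} \<subseteq> {a..b}" by auto
  then show ?thesis by (rule finite_subset) (rule finite_atLeastAtMost_int)
qed

lemma sum_shift_by_one:
  fixes f :: "int \<Rightarrow> int"
  assumes "\<And>k. R' (k + 1) \<longleftrightarrow> R k"
  shows "(\<Sum>k | k \<in> {a..b} \<and> R k. f (k + 1)) = (\<Sum>k | k \<in> {a+1..b+1} \<and> R' k. f k)"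
proof -
  have "R (k - 1) \<longleftrightarrow> R' k" for k using assms[of "k - 1"] by simp
  then show ?thesis
    by (intro sum.reindex_bij_witness[of _ "\<lambda>k. k - 1" "\<lambda>k. k + 1"]) (auto simp: assms)
qed

lemma sum_residue_shift:
  fixes f :: "int \<Rightarrow> int"
  assumes f: "\<And>k. \<bar>k\<bar> \<ge> M \<Longrightarrow> f k = 0"
  shows "(\<Sum>k | k \<in> {-M..M} \<and> k mod int l = j mod int l. f (k + 1)) =
    (\<Sum>k | k \<in> {-M..M} \<and> k mod int l = (j + 1) mod int l. f k)"
proof -
  have shift: "(k + 1) mod int l = (j + 1) mod int l \<longleftrightarrow> k mod int l = j mod int l" for k
    by (simp add: mod_eq_dvd_iff)
  have "(\<Sum>k | k \<in> {-M..M} \<and> k mod int l = j mod int l. f (k + 1)) =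
      (\<Sum>k | k \<in> {-M+1..M+1} \<and> k mod int l = (j + 1) mod int l. f k)"
    by (rule sum_shift_by_one) (rule shift)
  also have "\<dots> = (\<Sum>k | k \<in> {-M..M+1} \<and> k mod int l = (j + 1) mod int l. f k)"
    by (rule sum.mono_neutral_left) (auto intro!: f finite_int_interval_Collect)
  also have "\<dots> = (\<Sum>k | k \<in> {-M..M} \<and> k mod int l = (j + 1) mod int l. f k)"
    by (rule sum.mono_neutral_right) (auto intro!: f finite_int_interval_Collect)
  finally show ?thesis .
qed

lemma res_count_eq_sum_diagonals:
  assumes fin: "finite (nodes lam)"
    and M: "\<And>x. x \<in> nodes lam \<Longrightarrow> \<bar>int (snd x) - int (fst x)\<bar> \<le> M"
  shows "res_count l j lam = (\<Sum>k | k \<in> {-M..M} \<and> k mod int l = j. card (diagonal (nodes lam) k))"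
proof -
  let ?S = "{x \<in> nodes lam. residue l x = j}" and ?T = "{k. k \<in> {-M..M} \<and> k mod int l = j}"
  let ?c = "\<lambda>x::nat \<times> nat. int (snd x) - int (fst x)"
  have "?c ` ?S \<subseteq> ?T" using M by (fastforce simp: residue_def split_beta abs_le_iff)
  then have "(\<Sum>k\<in>?T. sum (\<lambda>_. 1::nat) {x \<in> ?S. ?c x = k}) = sum (\<lambda>_. 1) ?S"
    using fin by (intro sum.group) (auto intro!: finite_int_interval_Collect)
  moreover have "{x \<in> ?S. ?c x = k} = diagonal (nodes lam) k" if "k \<in> ?T" for k
    using that by (auto simp: diagonal_def residue_def)
  ultimately show ?thesis by (simp add: res_count_def)
qed

text \<open>Suppose that \<open>lam\<close> has a descent at \<open>i\<close> and \<open>mu\<close> has none. By the closure property of cores,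
  \<open>lam\<close> has descents at all \<open>k \<le> i\<close> in the class of \<open>i\<close> modulo \<open>l\<close>, and \<open>mu\<close> has none at any
  \<open>k \<ge> i\<close> in it. So the difference \<open>g\<close> of the descent indicators is nonnegative on the class and
  positive at \<open>i\<close>. But by \<open>diff\<close> its sum over the class is zero: it is the difference between the
  values of \<open>int (res_count l j lam) - int (res_count l j mu)\<close> at two adjacent residues \<open>j\<close>, both \<open>w\<close>.\<close>

lemma descents_subset_of_core:
  assumes l: "l \<ge> 1"
    and lam: "is_partition lam" and mu: "is_partition mu"
    and core_lam: "\<nexists>nu. remove_rim_hook l lam nu" and core_mu: "\<nexists>nu. remove_rim_hook l mu nu"
    and diff: "\<And>j. 0 \<le> j \<Longrightarrow> j < int l \<Longrightarrow> int (res_count l j lam) - int (res_count l j mu) = w"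
    and desc: "rim_row (nodes lam) i \<noteq> rim_row (nodes lam) (i + 1)"
  shows "rim_row (nodes mu) i \<noteq> rim_row (nodes mu) (i + 1)"
proof
  let ?r = "rim_row (nodes lam)" and ?s = "rim_row (nodes mu)"
  have L: "young_diagram (nodes lam)" and U: "young_diagram (nodes mu)"
    using lam mu by (auto intro: young_diagram_nodes)
  have fin: "finite (nodes lam)" "finite (nodes mu)" using L U by (auto simp: young_diagram_def)
  assume flat: "?s i = ?s (i + 1)"
  \<comment> \<open>The starting rows of the diagonals cancel: \<open>f k\<close> is also the difference of the diagonal lengths.\<close>
  define f where "f k = ?r k - ?s k" for k
  define g where "g k = f k - f (k + 1)" for k
  let ?c = "\<lambda>x::nat \<times> nat. \<bar>int (snd x) - int (fst x)\<bar>"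
  define M where "M = Max (insert \<bar>i\<bar> (?c ` (nodes lam \<union> nodes mu))) + 1"
  have M: "?c x < M" if "x \<in> nodes lam \<union> nodes mu" for x
    unfolding M_def using fin that by (simp add: zless_add1_eq Max_ge_iff)
  have i: "\<bar>i\<bar> < M"
    unfolding M_def using fin by (simp add: zless_add1_eq) 
  have f0: "f k = 0" if "\<bar>k\<bar> \<ge> M" for k
  proof -
    have "diagonal (nodes lam) k = {}" "diagonal (nodes mu) k = {}"
      using that M by (fastforce simp: diagonal_def)+
    then show ?thesis by (simp add: f_def rim_row_def)
  qed
  have sum_f: "(\<Sum>k | k \<in> {-M..M} \<and> k mod int l = j mod int l. f k) = w" for j
  proof -
    have "(\<Sum>k | k \<in> {-M..M} \<and> k mod int l = j mod int l. f k) =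
        int (res_count l (j mod int l) lam) - int (res_count l (j mod int l) mu)"
      using M fin
      by (subst (1 2) res_count_eq_sum_diagonals[where M = M])
        (auto simp: f_def rim_row_def sum_subtractf less_imp_le)
    then show ?thesis using diff[of "j mod int l"] l by simp
  qed
  let ?C = "{k. k \<in> {-M..M} \<and> k mod int l = i mod int l}"
  have "sum g ?C = 0"
    unfolding g_def sum_subtractf
    using sum_residue_shift[of M f l i, OF f0] sum_f[of i] sum_f[of "i + 1"] by simp
  moreover have "g k \<ge> 0" if "k \<in> ?C" for k
  proof -
    have down_r: "?r (i - int l * int n) \<noteq> ?r (i - int l * int n + 1)" for n
    proof (induction n)
      case (Suc n)
      show ?case using rim_row_descent_of_core[OF lam core_lam l Suc] by (simp add: algebra_simps)
    qed (use desc in simp)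
    have up_s: "?s (i + int l * int n) = ?s (i + int l * int n + 1)" for n
    proof (induction n)
      case (Suc n)
      show ?case
        using rim_row_descent_of_core[OF mu core_mu l, of "i + int l * int (Suc n)"] Suc
        by (auto simp: algebra_simps)
    qed (use flat in simp)
    have "int l dvd k - i" using that by (simp add: mod_eq_dvd_iff)
    then obtain q where "k - i = int l * q" by (elim dvdE)
    then have q: "k = i + int l * q" by simp
    show ?thesis
    proof (cases "q \<ge> 0")
      case True
      then have "?s k = ?s (k + 1)" using up_s[of "nat q"] q by simp
      then show ?thesis using rim_row_step(1)[OF L, of k] by (simp add: g_def f_def)
    next
      case False
      then have "?r k \<noteq> ?r (k + 1)" using down_r[of "nat (- q)"] q by simp
      then show ?thesis
        using rim_row_step(1)[OF L, of k] rim_row_step(2)[OF U, of k] by (simp add: g_def f_def)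
    qed
  qed
  moreover have "finite ?C" by (simp add: finite_int_interval_Collect)
  moreover have "i \<in> ?C" using i by auto
  ultimately have "g i = 0" by (metis (no_types, lifting) sum_nonneg_eq_0_iff)
  then show False using desc flat by (simp add: g_def f_def)
qed

text \<open>By symmetry the two cores have the same descents, so their boundary paths differ by a constant.
  The constant is zero because far out both paths run along row zero.\<close>

lemma core_eq_of_res_count_diff:
  assumes l: "l \<ge> 1"
    and lam: "is_partition lam" and mu: "is_partition mu"
    and core_lam: "\<nexists>nu. remove_rim_hook l lam nu" and core_mu: "\<nexists>nu. remove_rim_hook l mu nu"
    and diff: "\<And>j. 0 \<le> j \<Longrightarrow> j < int l \<Longrightarrow> int (res_count l j lam) - int (res_count l j mu) = w"
  shows "lam = mu"
proof -
  let ?r = "rim_row (nodes lam)" and ?s = "rim_row (nodes mu)"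
  have L: "young_diagram (nodes lam)" and U: "young_diagram (nodes mu)"
    using lam mu by (auto intro: young_diagram_nodes)
  have fin: "finite (nodes lam)" "finite (nodes mu)" using L U by (auto simp: young_diagram_def)
  have diff': "int (res_count l j mu) - int (res_count l j lam) = - w" if "0 \<le> j" "j < int l" for j
    using diff[OF that] by simp
  have "?r k \<noteq> ?r (k + 1) \<longleftrightarrow> ?s k \<noteq> ?s (k + 1)" for k
    using descents_subset_of_core[OF l lam mu core_lam core_mu diff]
      descents_subset_of_core[OF l mu lam core_mu core_lam diff'] by blast
  then have step: "?r k - ?s k = ?r (k + 1) - ?s (k + 1)" for k
    using rim_row_step[OF L, of k] rim_row_step[OF U, of k] by (smt (verit))
  define K where "K = Max (insert 0 ((\<lambda>x. int (snd x) - int (fst x)) ` (nodes lam \<union> nodes mu))) + 1"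
  have K: "int (snd x) - int (fst x) < K" if "x \<in> nodes lam \<union> nodes mu" for x
    unfolding K_def using fin that by (simp add: zless_add1_eq)
  have far: "?r k - ?s k = 0" if "k \<ge> K" for k
  proof -
    have "diagonal (nodes lam) k = {}" "diagonal (nodes mu) k = {}"
      using that K by (fastforce simp: diagonal_def)+
    then show ?thesis by (simp add: rim_row_def)
  qed
  have "?r k - ?s k = ?r (k + int n) - ?s (k + int n)" for k n
  proof (induction n)
    case (Suc n)
    then show ?case using step[of "k + int n"] by (simp add: algebra_simps)
  qed simp
  then have "?r k = ?s k" for k
    using far[of "k + int (nat (K - k))"] by (metis (no_types, opaque_lifting) diff_add_cancel
        eq_iff_diff_eq_0 int_nat_eq le_add_same_cancel1 nle_le add.commute diff_ge_0_iff_ge)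
  then have "nodes lam = nodes mu"
    by (auto simp: mem_iff_le_rim_row[OF L] mem_iff_le_rim_row[OF U])
  then show ?thesis by (rule nodes_inj[OF lam mu])
qed

lemma is_core_of_exists:
  assumes "is_partition lam" "l \<ge> 1"
  shows "\<exists>kap. is_core_of l lam kap"
  using assms(1)
proof (induction "card (nodes lam)" arbitrary: lam rule: less_induct)
  case less
  show ?case
  proof (cases "\<exists>mu. remove_rim_hook l lam mu")
    case False
    then show ?thesis by (auto simp: is_core_of_def)
  next
    case True
    then obtain mu x where mu: "remove_rim_hook l lam mu" "is_partition mu" and x: "x \<in> nodes lam"
      "card (rim_hook lam x) = l" "nodes mu = nodes lam - rim_hook lam x"
      unfolding remove_rim_hook_def by blast
    have "rim_hook lam x \<noteq> {}" using x(2) assms(2) by auto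
    moreover have "rim_hook lam x \<subseteq> nodes lam" by (auto simp: rim_hook_def split: prod.splits)
    ultimately have "nodes mu \<subset> nodes lam" using x(3) by blast
    then have "card (nodes mu) < card (nodes lam)"
      using young_diagram_nodes[OF less.prems] by (simp add: young_diagram_def psubset_card_mono)
    then obtain kap where "is_core_of l mu kap" using less.hyps mu(2) by blast
    then show ?thesis using mu(1) unfolding is_core_of_def
      by (meson converse_rtranclp_into_rtranclp)
  qed
qed

lemma res_count_core:
  assumes "(remove_rim_hook l)\<^sup>*\<^sup>* lam kap" "is_partition lam"
  shows "is_partition kap \<and>
    (\<exists>w. \<forall>j. 0 \<le> j \<longrightarrow> j < int l \<longrightarrow> int (res_count l j lam) - int (res_count l j kap) = w)"
  using assms
proof (induction rule: rtranclp_induct)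
  case (step mu nu)
  then obtain w where
    "\<And>j. 0 \<le> j \<Longrightarrow> j < int l \<Longrightarrow> int (res_count l j lam) - int (res_count l j mu) = w" by blast
  then have "int (res_count l j lam) - int (res_count l j nu) = w + 1" if "0 \<le> j" "j < int l" for j
    using res_count_remove_rim_hook[OF step.hyps(2) that] that by fastforce
  moreover have "is_partition nu" using step.hyps(2) by (simp add: remove_rim_hook_def)
  ultimately show ?case by blast
qed auto

text \<open>The case \<open>lam = mu\<close> is the independence of the core from the order of removals. The general
  case has the same proof, since the residue counts of a partition and of any of its cores differ by a
  constant, the number of removed rim hooks.\<close>

lemma core_unique_of_res_count_eq:
  assumes l: "l \<ge> 1" and lam: "is_partition lam" and mu: "is_partition mu"
    and res: "\<And>j. 0 \<le> j \<Longrightarrow> j < int l \<Longrightarrow> res_count l j lam = res_count l j mu"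
    and kap: "is_core_of l lam kap" and kap': "is_core_of l mu kap'"
  shows "kap = kap'"
proof -
  obtain w where w: "is_partition kap"
    "\<And>j. 0 \<le> j \<Longrightarrow> j < int l \<Longrightarrow> int (res_count l j lam) - int (res_count l j kap) = w"
    using res_count_core[of l lam kap] kap lam unfolding is_core_of_def by blast
  obtain w' where w': "is_partition kap'"
    "\<And>j. 0 \<le> j \<Longrightarrow> j < int l \<Longrightarrow> int (res_count l j mu) - int (res_count l j kap') = w'"
    using res_count_core[of l mu kap'] kap' mu unfolding is_core_of_def by blast
  show ?thesis
  proof (rule core_eq_of_res_count_diff[OF l w(1) w'(1)])
    show "\<nexists>nu. remove_rim_hook l kap nu" "\<nexists>nu. remove_rim_hook l kap' nu"
      using kap kap' by (auto simp: is_core_of_def)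
    fix j assume "0 \<le> j" "j < int l"
    then show "int (res_count l j kap) - int (res_count l j kap') = w' - w"
      using w(2)[of j] w'(2)[of j] res[of j] by linarith
  qed
qed

lemma core_eq_of_res_count_eq:
  assumes "l \<ge> 1" "is_partition lam" "is_partition mu"
    and "\<And>j. 0 \<le> j \<Longrightarrow> j < int l \<Longrightarrow> res_count l j lam = res_count l j mu"
  shows "core l lam = core l mu"
proof -
  obtain kap where kap: "is_core_of l mu kap" using is_core_of_exists assms by blast
  have "is_core_of l lam kap' \<longleftrightarrow> is_core_of l mu kap'" for kap'
    using core_unique_of_res_count_eq[OF assms] core_unique_of_res_count_eq[OF assms(1,3,3)] is_core_of_exists[OF _ assms(1)] kap assms(2)
    by metis
  then show ?thesis by (simp add: core_def)
qed

section \<open>Reduction of residues\<close>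

text \<open>Written as a sum over nodes, the content can be pushed through linear maps one node at a time.\<close>

lemma content_eq_sum_nodes:
  assumes "e \<ge> 1" "is_partition lam"
  shows "content e lam = (\<Sum>x\<in>nodes lam. frag_of (residue e x))"
proof -
  have fin: "finite (nodes lam)" using young_diagram_nodes[OF assms(2)] by (simp add: young_diagram_def)
  have const: "frag_cmul (int n) y = (\<Sum>x\<in>S. y)" if "card S = n" for n and S :: "(nat \<times> nat) set" and y :: "int \<Rightarrow>\<^sub>0 int"
  proof -
    have "frag_cmul (int m) y = of_nat m * y" for m
      by (induction m) (auto simp: frag_cmul_distrib algebra_simps)
    then show ?thesis using that by simp
  qed
  have "content e lam = (\<Sum>i\<in>{0..<int e}. \<Sum>x\<in>{x \<in> nodes lam. residue e x = i}. frag_of (residue e x))"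
    unfolding content_def
  proof (rule sum.cong[OF refl])
    fix i assume "i \<in> {0..<int e}"
    then show "frag_cmul (int (res_count e i lam)) (basis_elt e i) =
        (\<Sum>x\<in>{x \<in> nodes lam. residue e x = i}. frag_of (residue e x))"
      by (subst const[of "{x \<in> nodes lam. residue e x = i}"]) (auto simp: res_count_def basis_elt_def)
  qed
  also have "\<dots> = (\<Sum>x\<in>nodes lam. frag_of (residue e x))"
    by (rule sum.group) (use fin assms(1) in \<open>auto simp: residue_def\<close>)
  finally show ?thesis .
qed

lemma lookup_content:
  assumes "e \<ge> 1" "is_partition lam"
  shows "Poly_Mapping.lookup (content e lam) j = int (res_count e j lam)"
proof -
  have fin: "finite (nodes lam)" using young_diagram_nodes[OF assms(2)] by (simp add: young_diagram_def)
  have "Poly_Mapping.lookup (content e lam) j = (\<Sum>x\<in>nodes lam. if j = residue e x then 1 else 0)"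
    by (simp add: content_eq_sum_nodes[OF assms] lookup_sum lookup_single when_def)
  also have "\<dots> = int (res_count e j lam)"
    using fin by (simp add: res_count_def sum.If_cases Int_def eq_commute)
  finally show ?thesis .
qed

definition reduce_residues :: "nat \<Rightarrow> (int \<Rightarrow>\<^sub>0 int) \<Rightarrow> (int \<Rightarrow>\<^sub>0 int)" where
  "reduce_residues d = frag_extend (\<lambda>i. frag_of (i mod int d))"

lemma reduce_residues_content:
  assumes "d dvd e" "e \<ge> 1" "is_partition lam"
  shows "reduce_residues d (content e lam) = content d lam"
proof -
  have fin: "finite (nodes lam)" using young_diagram_nodes[OF assms(3)] by (simp add: young_diagram_def)
  have "d \<ge> 1" using assms(1,2) by (metis One_nat_def Suc_leI dvd_pos_nat less_le_trans zero_less_one)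
  have "residue e x mod int d = residue d x" for x
    using assms(1) by (auto simp: residue_def mod_mod_cancel split: prod.splits)
  then show ?thesis
    using fin assms \<open>d \<ge> 1\<close>
    by (simp add: content_eq_sum_nodes reduce_residues_def frag_extend_sum)
qed

lemma reduce_residues_sigma:
  assumes "d dvd e" "e \<ge> 1" "is_partition lam"
  shows "reduce_residues d (sigma e d (content e lam)) = reduce_residues d (content e lam)"
proof -
  have fin: "finite (nodes lam)" using young_diagram_nodes[OF assms(3)] by (simp add: young_diagram_def)
  have "(i - int d) mod int e mod int d = i mod int d" for i
    using assms(1) by (simp add: mod_mod_cancel)
  then show ?thesis
    using fin assms
    by (simp add: content_eq_sum_nodes reduce_residues_def sigma_def basis_elt_def frag_extend_sum)
qed

theorem proposition4p13:
  fixes e e' :: nat and alpha :: "int \<Rightarrow>\<^sub>0 int" and lam mu :: "nat list"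
  assumes "e \<ge> 2"
    and "e' \<in> {1..e - 1}"
    and "e' dvd e"
    and "alpha \<in> Q0 e"
    and "sigma e e' alpha \<in> Q0 e"
    and "is_partition lam"
    and "is_partition mu"
    and "content e lam = alpha"
    and "content e mu = sigma e e' alpha"
  shows "core e' lam = core e' mu"
proof -
  have e: "e \<ge> 1" and e': "e' \<ge> 1" using assms(1,2) by auto
  have "content e' lam = content e' mu"
    using reduce_residues_content[OF assms(3) e] reduce_residues_sigma[OF assms(3) e] assms(6-9) by metis
  then have "res_count e' j lam = res_count e' j mu" for j
    using lookup_content[OF e'] assms(6,7) by (metis of_nat_eq_iff)
  then show ?thesis using core_eq_of_res_count_eq[OF e' assms(6,7)] by blast
qed

end
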